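(* Let $\mathcal N\subseteq\mathcal B(\mathcal H)$ be a von Neumann algebra and $\mathcal S\subseteq\mathcal B(\mathcal H)$ a finite set such that the commutant $\mathcal S'$ is a von Neumann algebra and there is a normal conditional expectation $E_{\mathrm{fix}}:\mathcal N\to\mathcal S'\cap\mathcal N$ (fixed). For every channel $\Phi:\mathcal N\to\mathcal N$ satisfying $\Phi\circ E_{\mathrm{fix}}=E_{\mathrm{fix}}$, $$\mathrm{Cost}_{\mathcal S}(\Phi)\le\mathrm{Cost}_{\mathcal S}(E_{\mathrm{fix}})\,\|\Phi-\mathrm{id}\|_{op},\qquad \mathrm{Cost}_{\mathcal S}^{cb}(\Phi)\le\mathrm{Cost}_{\mathcal S}^{cb}(E_{\mathrm{fix}})\,\|\Phi-\mathrm{id}\|_{cb}.$$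
   Context: A channel is a normal unital completely positive map $\Phi:\mathcal N\to\mathcal N$; $\Phi^{(n)}=\mathrm{id}_{\mathbb M_n}\otimes\Phi$. For $x\in\mathbb M_n(\mathcal N)$ put $|||x|||_{\mathcal S^{(n)}}=\sup_{s\in\mathcal S}\|[\mathbb I_n\otimes s,x]\|_{op}$. Then $$\mathrm{Cost}_{\mathcal S}^{cb}(\Phi)=\sup_{n\ge1}\sup\{\|\Phi^{(n)}(x)-x\|_{op}: x=x^*\in\mathbb M_n(\mathcal N),\ |||x|||_{\mathcal S^{(n)}}\le1\},$$ and $\mathrm{Cost}_{\mathcal S}(\Phi)$ is the same with only $n=1$. $\|\cdot\|_{op}$ of a map on $\mathcal N$ is its norm as an operator on $\mathcal N$ with the operator norm, and $\|\cdot\|_{cb}$ is the completely bounded norm. *)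

theory Defs
  imports "HOL-Analysis.Analysis"
begin

section \<open>Complex Hilbert spaces\<close>

text \<open>
  The distribution only has real inner product spaces.  A complex Hilbert space is a complete one
  together with a complex scalar multiplication extending the real one, and a sesquilinear form
  (conjugate linear in the first argument) whose real part is the given inner product.  The norm
  of \<^class>\<open>real_inner\<close> is then the norm induced by the complex inner product.
\<close>

class complex_hilbert = real_inner + complete_space +
  fixes scaleC :: "complex \<Rightarrow> 'a \<Rightarrow> 'a"  (infixr \<open>*\<^sub>C\<close> 75)
    and cinner :: "'a \<Rightarrow> 'a \<Rightarrow> complex"
  assumes scaleC_add_right: "c *\<^sub>C (x + y) = c *\<^sub>C x + c *\<^sub>C y"
    and scaleC_add_left: "(c + d) *\<^sub>C x = c *\<^sub>C x + d *\<^sub>C x"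
    and scaleC_scaleC: "c *\<^sub>C d *\<^sub>C x = (c * d) *\<^sub>C x"
    and scaleC_of_real: "complex_of_real r *\<^sub>C x = scaleR r x"
    and cinner_commute: "cinner x y = cnj (cinner y x)"
    and cinner_add_right: "cinner x (y + z) = cinner x y + cinner x z"
    and cinner_scaleC_right: "cinner x (c *\<^sub>C y) = c * cinner x y"
    and Re_cinner: "Re (cinner x y) = inner x y"

instantiation complex :: complex_hilbert
begin

definition scaleC_complex :: "complex \<Rightarrow> complex \<Rightarrow> complex"
  where "scaleC_complex c z = c * z"

definition cinner_complex :: "complex \<Rightarrow> complex \<Rightarrow> complex"
  where "cinner_complex w z = cnj w * z"

instance
  by standard
    (simp_all add: scaleC_complex_def cinner_complex_def algebra_simps scaleR_conv_of_real
      inner_complex_def)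

end

lemma cinner_scaleC_left: "cinner (c *\<^sub>C x) y = cnj c * cinner x y"
  by (metis cinner_commute cinner_scaleC_right complex_cnj_mult)

lemma norm_scaleC: "norm (c *\<^sub>C (x::'a::complex_hilbert)) = cmod c * norm x"
proof -
  have "cinner x x = complex_of_real (inner x x)"
  proof (rule complex_eqI)
    have "Im (cinner x x) = - Im (cinner x x)"
      using arg_cong[OF cinner_commute[of x x], of Im] by simp
    then show "Im (cinner x x) = Im (complex_of_real (inner x x))"
      by simp
  qed (simp add: Re_cinner)
  then have "cinner (c *\<^sub>C x) (c *\<^sub>C x) = complex_of_real ((cmod c)\<^sup>2 * inner x x)"
    by (simp add: cinner_scaleC_left cinner_scaleC_right complex_norm_square mult_ac
        del: of_real_power)
  then have "inner (c *\<^sub>C x) (c *\<^sub>C x) = (cmod c)\<^sup>2 * inner x x"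
    by (metis Re_cinner Re_complex_of_real)
  then show ?thesis
    by (simp add: norm_eq_sqrt_inner real_sqrt_mult)
qed

lemma bounded_linear_scaleC: "bounded_linear ((*\<^sub>C) c :: 'a::complex_hilbert \<Rightarrow> 'a)"
proof (rule bounded_linear_intro)
  show "c *\<^sub>C (scaleR r x) = scaleR r (c *\<^sub>C x)" for r and x :: 'a
    by (metis mult.commute scaleC_of_real scaleC_scaleC)
  show "norm (c *\<^sub>C x) \<le> norm x * cmod c" for x :: 'a
    by (simp add: norm_scaleC)
qed (rule scaleC_add_right)


section \<open>Bounded operators and von Neumann algebras\<close>

text \<open>
  The type of bounded real linear maps contains the bounded operators on the complex Hilbert space
  as the subset of complex linear ones.  Its norm restricts to the usual operator norm.
\<close>

definition bounded_ops :: "('h::complex_hilbert \<Rightarrow>\<^sub>L 'h) set"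
  where "bounded_ops = {A. \<forall>c x. blinfun_apply A (c *\<^sub>C x) = c *\<^sub>C blinfun_apply A x}"

lift_definition scaleC_op :: "complex \<Rightarrow> ('h::complex_hilbert \<Rightarrow>\<^sub>L 'h) \<Rightarrow> ('h \<Rightarrow>\<^sub>L 'h)"
  is "\<lambda>c A x. c *\<^sub>C A x"
  by (rule bounded_linear_compose[OF bounded_linear_scaleC])

text \<open>
  The Hilbert space adjoint; for a complex linear operator it exists by Riesz representation, it is
  unique, and it is again complex linear.
\<close>

definition cadj :: "('h::complex_hilbert \<Rightarrow>\<^sub>L 'h) \<Rightarrow> ('h \<Rightarrow>\<^sub>L 'h)"
  where "cadj A =
    (THE B. \<forall>x y. cinner (blinfun_apply A x) y = cinner x (blinfun_apply B y))"

definition weak_operator_topology :: "('h::complex_hilbert \<Rightarrow>\<^sub>L 'h) topology"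
  where "weak_operator_topology = topology_generated_by
    {{A \<in> bounded_ops. cinner x (blinfun_apply A y) \<in> U} | x y U. open U}"

text \<open>
  The ultraweak topology is the initial topology for the functionals
  A \<mapsto> \<open>\<Sum>k. \<langle>\<xi> k, A (\<eta> k)\<rangle>\<close> with square summable \<open>\<xi>\<close> and \<open>\<eta>\<close>.
\<close>

definition ultraweak_topology :: "('h::complex_hilbert \<Rightarrow>\<^sub>L 'h) topology"
  where "ultraweak_topology = topology_generated_by
    {{A \<in> bounded_ops. (\<Sum>k. cinner (\<xi> k) (blinfun_apply A (\<eta> k))) \<in> U} | \<xi> \<eta> U.
      summable (\<lambda>k. (norm (\<xi> k))\<^sup>2) \<and> summable (\<lambda>k. (norm (\<eta> k))\<^sup>2) \<and> open U}"

definition von_neumann_algebra :: "('h::complex_hilbert \<Rightarrow>\<^sub>L 'h) set \<Rightarrow> bool"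
  where "von_neumann_algebra N \<longleftrightarrow>
    N \<subseteq> bounded_ops \<and> id_blinfun \<in> N \<and>
    (\<forall>A\<in>N. \<forall>B\<in>N. A + B \<in> N \<and> A o\<^sub>L B \<in> N) \<and>
    (\<forall>c. \<forall>A\<in>N. scaleC_op c A \<in> N) \<and>
    (\<forall>A\<in>N. cadj A \<in> N) \<and>
    closedin weak_operator_topology N"

definition commutant :: "('h::complex_hilbert \<Rightarrow>\<^sub>L 'h) set \<Rightarrow> ('h \<Rightarrow>\<^sub>L 'h) set"
  where "commutant S = {A \<in> bounded_ops. \<forall>s\<in>S. A o\<^sub>L s = s o\<^sub>L A}"


section \<open>Matrices over an operator algebra\<close>

text \<open>
  An n by n matrix of operators is a function of two indices of which only the entries with both
  indices below n matter.  It acts on the n-fold Hilbert space direct sum of \<open>'h\<close>, whose vectors are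
  functions v of an index below n with norm \<^term>\<open>L2_set (\<lambda>i. norm (v i)) {..<n}\<close>.
\<close>

type_synonym 'h op_matrix = "nat \<Rightarrow> nat \<Rightarrow> ('h \<Rightarrow>\<^sub>L 'h)"

definition matrices_over :: "nat \<Rightarrow> ('h::complex_hilbert \<Rightarrow>\<^sub>L 'h) set \<Rightarrow> 'h op_matrix set"
  where "matrices_over n N = {x. \<forall>i<n. \<forall>j<n. x i j \<in> N}"

definition mat_times :: "nat \<Rightarrow> 'h::complex_hilbert op_matrix \<Rightarrow> 'h op_matrix \<Rightarrow> 'h op_matrix"
  where "mat_times n x y = (\<lambda>i j. \<Sum>k<n. x i k o\<^sub>L y k j)"

definition mat_diff :: "'h::complex_hilbert op_matrix \<Rightarrow> 'h op_matrix \<Rightarrow> 'h op_matrix"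
  where "mat_diff x y = (\<lambda>i j. x i j - y i j)"

definition mat_selfadjoint :: "nat \<Rightarrow> 'h::complex_hilbert op_matrix \<Rightarrow> bool"
  where "mat_selfadjoint n x \<longleftrightarrow> (\<forall>i<n. \<forall>j<n. x i j = cadj (x j i))"

definition mat_positive :: "nat \<Rightarrow> 'h::complex_hilbert op_matrix \<Rightarrow> bool"
  where "mat_positive n x \<longleftrightarrow>
    (\<forall>v. (\<Sum>i<n. \<Sum>j<n. cinner (v i) (blinfun_apply (x i j) (v j))) \<in> \<real>\<^sub>\<ge>\<^sub>0)"

definition mat_norm :: "nat \<Rightarrow> 'h::complex_hilbert op_matrix \<Rightarrow> ennreal"
  where "mat_norm n x =
    (SUP v\<in>{v. L2_set (\<lambda>j. norm (v j)) {..<n} \<le> 1}.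
      ennreal (L2_set (\<lambda>i. norm (\<Sum>j<n. blinfun_apply (x i j) (v j))) {..<n}))"

text \<open>The matrix \<open>I\<^sub>n \<otimes> s\<close>.\<close>

definition mat_ampl :: "('h::complex_hilbert \<Rightarrow>\<^sub>L 'h) \<Rightarrow> 'h op_matrix"
  where "mat_ampl s = (\<lambda>i j. if i = j then s else 0)"

text \<open>The amplification \<open>id \<otimes> T\<close> of a map T, acting entrywise.\<close>

definition map_ampl ::
    "(('h::complex_hilbert \<Rightarrow>\<^sub>L 'h) \<Rightarrow> ('h \<Rightarrow>\<^sub>L 'h)) \<Rightarrow> 'h op_matrix \<Rightarrow> 'h op_matrix"
  where "map_ampl T x = (\<lambda>i j. T (x i j))"


section \<open>Channels and conditional expectations\<close>

text \<open>
  Maps on an algebra N are total functions on operators whose values outside N are irrelevant.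
\<close>

definition clinear_map_on ::
    "('h::complex_hilbert \<Rightarrow>\<^sub>L 'h) set \<Rightarrow> (('h \<Rightarrow>\<^sub>L 'h) \<Rightarrow> ('h \<Rightarrow>\<^sub>L 'h)) \<Rightarrow> bool"
  where "clinear_map_on N T \<longleftrightarrow>
    (\<forall>x\<in>N. \<forall>y\<in>N. T (x + y) = T x + T y) \<and>
    (\<forall>c. \<forall>x\<in>N. T (scaleC_op c x) = scaleC_op c (T x))"

definition n_positive_on ::
    "nat \<Rightarrow> ('h::complex_hilbert \<Rightarrow>\<^sub>L 'h) set \<Rightarrow> (('h \<Rightarrow>\<^sub>L 'h) \<Rightarrow> ('h \<Rightarrow>\<^sub>L 'h)) \<Rightarrow> bool"
  where "n_positive_on n N T \<longleftrightarrow>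
    (\<forall>x\<in>matrices_over n N. mat_positive n x \<longrightarrow> mat_positive n (map_ampl T x))"

definition completely_positive_on ::
    "('h::complex_hilbert \<Rightarrow>\<^sub>L 'h) set \<Rightarrow> (('h \<Rightarrow>\<^sub>L 'h) \<Rightarrow> ('h \<Rightarrow>\<^sub>L 'h)) \<Rightarrow> bool"
  where "completely_positive_on N T \<longleftrightarrow> (\<forall>n\<ge>1. n_positive_on n N T)"

definition normal_map ::
    "('h::complex_hilbert \<Rightarrow>\<^sub>L 'h) set \<Rightarrow> ('h \<Rightarrow>\<^sub>L 'h) set \<Rightarrow> (('h \<Rightarrow>\<^sub>L 'h) \<Rightarrow> ('h \<Rightarrow>\<^sub>L 'h)) \<Rightarrow> bool"
  where "normal_map N M T \<longleftrightarrow>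
    continuous_map (subtopology ultraweak_topology N) (subtopology ultraweak_topology M) T"

definition channel ::
    "('h::complex_hilbert \<Rightarrow>\<^sub>L 'h) set \<Rightarrow> (('h \<Rightarrow>\<^sub>L 'h) \<Rightarrow> ('h \<Rightarrow>\<^sub>L 'h)) \<Rightarrow> bool"
  where "channel N \<Phi> \<longleftrightarrow>
    \<Phi> ` N \<subseteq> N \<and> clinear_map_on N \<Phi> \<and> \<Phi> id_blinfun = id_blinfun \<and>
    completely_positive_on N \<Phi> \<and> normal_map N N \<Phi>"

definition conditional_expectation ::
    "('h::complex_hilbert \<Rightarrow>\<^sub>L 'h) set \<Rightarrow> ('h \<Rightarrow>\<^sub>L 'h) set \<Rightarrow> (('h \<Rightarrow>\<^sub>L 'h) \<Rightarrow> ('h \<Rightarrow>\<^sub>L 'h)) \<Rightarrow> bool"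
  where "conditional_expectation N M E \<longleftrightarrow>
    E ` N \<subseteq> M \<and> clinear_map_on N E \<and> n_positive_on 1 N E \<and>
    (\<forall>a\<in>M. E a = a) \<and>
    (\<forall>a\<in>M. \<forall>b\<in>M. \<forall>x\<in>N. E (a o\<^sub>L x o\<^sub>L b) = a o\<^sub>L E x o\<^sub>L b)"


section \<open>Norms of maps and the cost of a channel\<close>

text \<open>
  All suprema are taken in \<^typ>\<open>ennreal\<close>: they may be infinite, the supremum over the empty
  set is 0, and 0 times infinity is 0.
\<close>

definition op_norm_on ::
    "('h::complex_hilbert \<Rightarrow>\<^sub>L 'h) set \<Rightarrow> (('h \<Rightarrow>\<^sub>L 'h) \<Rightarrow> ('h \<Rightarrow>\<^sub>L 'h)) \<Rightarrow> ennreal"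
  where "op_norm_on N T = (SUP x\<in>{x\<in>N. norm x \<le> 1}. ennreal (norm (T x)))"

definition cb_norm_on ::
    "('h::complex_hilbert \<Rightarrow>\<^sub>L 'h) set \<Rightarrow> (('h \<Rightarrow>\<^sub>L 'h) \<Rightarrow> ('h \<Rightarrow>\<^sub>L 'h)) \<Rightarrow> ennreal"
  where "cb_norm_on N T =
    (SUP n\<in>{1..}. SUP x\<in>{x\<in>matrices_over n N. mat_norm n x \<le> 1}. mat_norm n (map_ampl T x))"

definition commutator_seminorm ::
    "nat \<Rightarrow> ('h::complex_hilbert \<Rightarrow>\<^sub>L 'h) set \<Rightarrow> 'h op_matrix \<Rightarrow> ennreal"
  where "commutator_seminorm n S x =
    (SUP s\<in>S. mat_norm n (mat_diff (mat_times n (mat_ampl s) x) (mat_times n x (mat_ampl s))))"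

definition cost_level ::
    "nat \<Rightarrow> ('h::complex_hilbert \<Rightarrow>\<^sub>L 'h) set \<Rightarrow> ('h \<Rightarrow>\<^sub>L 'h) set \<Rightarrow>
      (('h \<Rightarrow>\<^sub>L 'h) \<Rightarrow> ('h \<Rightarrow>\<^sub>L 'h)) \<Rightarrow> ennreal"
  where "cost_level n N S \<Phi> =
    (SUP x\<in>{x\<in>matrices_over n N. mat_selfadjoint n x \<and> commutator_seminorm n S x \<le> 1}.
      mat_norm n (mat_diff (map_ampl \<Phi> x) x))"

definition cost ::
    "('h::complex_hilbert \<Rightarrow>\<^sub>L 'h) set \<Rightarrow> ('h \<Rightarrow>\<^sub>L 'h) set \<Rightarrow>
      (('h \<Rightarrow>\<^sub>L 'h) \<Rightarrow> ('h \<Rightarrow>\<^sub>L 'h)) \<Rightarrow> ennreal"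
  where "cost N S \<Phi> = cost_level 1 N S \<Phi>"

definition cost_cb ::
    "('h::complex_hilbert \<Rightarrow>\<^sub>L 'h) set \<Rightarrow> ('h \<Rightarrow>\<^sub>L 'h) set \<Rightarrow>
      (('h \<Rightarrow>\<^sub>L 'h) \<Rightarrow> ('h \<Rightarrow>\<^sub>L 'h)) \<Rightarrow> ennreal"
  where "cost_cb N S \<Phi> = (SUP n\<in>{1..}. cost_level n N S \<Phi>)"

end

theory Submission
  imports Defs
begin

text \<open>
  Since \<open>\<Phi>\<close> fixes the range of \<open>E\<close>, the map \<open>\<Phi> - id\<close> takes the same value at \<open>x\<close> and at
  \<open>x - E x\<close>.  The norm of \<open>x - E x\<close> is at most the cost of \<open>E\<close> when \<open>x\<close> is a competitor in the cost of
  \<open>\<Phi>\<close>, because both costs are suprema over the same competitors.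
\<close>

text \<open>Algebras and maps are specified through complex scalars, whereas subtraction and
  rescaling to the unit ball use real ones. This is the bridge between them.\<close>

lemma scaleC_op_of_real: "scaleC_op (complex_of_real r) A = r *\<^sub>R A"
  by (rule blinfun_eqI) (simp add: scaleC_op.rep_eq scaleC_of_real scaleR_blinfun.rep_eq)

lemma von_neumann_algebra_scaleR:
  assumes "von_neumann_algebra N" "x \<in> N"
  shows "r *\<^sub>R x \<in> N"
  using assms unfolding von_neumann_algebra_def by (metis scaleC_op_of_real)

lemma von_neumann_algebra_diff:
  assumes "von_neumann_algebra N" "x \<in> N" "y \<in> N"
  shows "x - y \<in> N"
proof -
  have "(-1) *\<^sub>R y \<in> N"
    using assms von_neumann_algebra_scaleR by blast
  then have "x + (-1) *\<^sub>R y \<in> N"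
    using assms unfolding von_neumann_algebra_def by blast
  then show ?thesis by simp
qed

lemma clinear_map_on_scaleR:
  assumes "clinear_map_on N T" "x \<in> N"
  shows "T (r *\<^sub>R x) = r *\<^sub>R T x"
  using assms unfolding clinear_map_on_def by (metis scaleC_op_of_real)

lemma clinear_map_on_diff:
  assumes "von_neumann_algebra N" "clinear_map_on N T" "x \<in> N" "y \<in> N"
  shows "T (x - y) = T x - T y"
proof -
  have "T ((x - y) + y) = T (x - y) + T y"
    using assms von_neumann_algebra_diff unfolding clinear_map_on_def by blast
  then show ?thesis by simp
qed

text \<open>Matrices are total functions on indices. Identities that rely on linearity over
  \<open>N\<close> hold only for entries with indices below \<open>n\<close>, so they are
  transferred to norms through this rule instead of by equality of functions.\<close>

lemma mat_norm_cong:
  assumes "\<And>i j. i < n \<Longrightarrow> j < n \<Longrightarrow> x i j = y i j"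
  shows "mat_norm n x = mat_norm n y"
  unfolding mat_norm_def
  by (intro SUP_cong refl arg_cong[where f = ennreal] L2_set_cong arg_cong[where f = norm] sum.cong)
    (use assms in auto)

lemma mat_norm_scaleR: "mat_norm n (\<lambda>i j. r *\<^sub>R x i j) = ennreal \<bar>r\<bar> * mat_norm n x"
proof -
  have "L2_set (\<lambda>i. norm (\<Sum>j<n. blinfun_apply (r *\<^sub>R x i j) (v j))) {..<n}
    = \<bar>r\<bar> * L2_set (\<lambda>i. norm (\<Sum>j<n. blinfun_apply (x i j) (v j))) {..<n}" for v
    by (simp add: scaleR_blinfun.rep_eq flip: scaleR_right.sum L2_set_right_distrib)
  then show ?thesis
    unfolding mat_norm_def by (simp add: ennreal_mult SUP_mult_left_ennreal)
qed

lemma mat_norm_minus: "mat_norm n (mat_diff x y) = mat_norm n (mat_diff y x)"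
  using mat_norm_scaleR[of n "-1" "mat_diff y x"] by (simp add: mat_diff_def)

lemma norm_le_L2_set:
  fixes n :: nat
  assumes "L2_set (\<lambda>j. norm (v j)) {..<n} \<le> c" "j < n"
  shows "norm (v j) \<le> c"
  using order_trans[OF member_le_L2_set assms(1)] assms(2) by simp

text \<open>Each component of a unit vector has norm at most 1, and the Euclidean norm is at most
  the sum of the components. The bound is crude, but it gives finiteness and is sharp for
  \<open>n = 1\<close>.\<close>

lemma mat_norm_le_sum: "mat_norm n x \<le> ennreal (\<Sum>i<n. \<Sum>j<n. norm (x i j))"
  unfolding mat_norm_def
proof (intro SUP_least ennreal_leI)
  fix v :: "nat \<Rightarrow> 'a"
  assume "v \<in> {v. L2_set (\<lambda>j. norm (v j)) {..<n} \<le> 1}"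
  then have v: "norm (v j) \<le> 1" if "j < n" for j
    using that norm_le_L2_set by blast
  have "norm (\<Sum>j<n. blinfun_apply (x i j) (v j)) \<le> (\<Sum>j<n. norm (x i j))" for i
  proof (rule sum_norm_le)
    fix j assume "j \<in> {..<n}"
    then show "norm (blinfun_apply (x i j) (v j)) \<le> norm (x i j)"
      using norm_blinfun[of "x i j" "v j"] mult_left_le[OF v[of j], of "norm (x i j)"] by simp
  qed
  then have "(\<Sum>i<n. norm (\<Sum>j<n. blinfun_apply (x i j) (v j))) \<le> (\<Sum>i<n. \<Sum>j<n. norm (x i j))"
    by (intro sum_mono)
  then show "L2_set (\<lambda>i. norm (\<Sum>j<n. blinfun_apply (x i j) (v j))) {..<n}
      \<le> (\<Sum>i<n. \<Sum>j<n. norm (x i j))"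
    by (rule order_trans[OF L2_set_le_sum, rotated]) simp
qed

lemma mat_norm_finite: "mat_norm n x < top"
  using mat_norm_le_sum[of n x] by (rule order_le_less_trans) simp

text \<open>Apply the matrix to a vector supported in coordinate \<open>j\<close> and read off
  coordinate \<open>i\<close> of the image.\<close>

lemma norm_entry_le_mat_norm:
  assumes "i < n" "j < n"
  shows "ennreal (norm (x i j)) \<le> mat_norm n x"
proof -
  obtain c where c: "mat_norm n x = ennreal c" "0 \<le> c"
    using mat_norm_finite[of n x] by (cases "mat_norm n x") auto
  have unit: "norm (blinfun_apply (x i j) w) \<le> c" if "norm w \<le> 1" for w
  proof -
    define v where "v = (\<lambda>k. if k = j then w else 0)"
    have "L2_set (\<lambda>k. norm (v k)) {..<n} = norm w"
      using assms by (simp add: v_def L2_set_def if_distrib[of norm] if_distrib[of "\<lambda>t. t\<^sup>2"] cong: if_cong)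
    then have "ennreal (L2_set (\<lambda>i. norm (\<Sum>k<n. blinfun_apply (x i k) (v k))) {..<n}) \<le> ennreal c"
      unfolding c(1)[symmetric] mat_norm_def using that by (intro SUP_upper) simp
    moreover have "(\<Sum>k<n. blinfun_apply (x i k) (v k)) = blinfun_apply (x i j) w" for i
      using assms by (simp add: v_def if_distrib cong: if_cong)
    ultimately show ?thesis
      using norm_le_L2_set[of "\<lambda>i. blinfun_apply (x i j) w" n c i] assms c by simp
  qed
  have "norm (blinfun_apply (x i j) w) \<le> c * norm w" for w
  proof (cases "w = 0")
    case False
    then show ?thesis
      using unit[of "w /\<^sub>R norm w"] by (simp add: blinfun.scaleR_right field_simps)
  qed simp
  then show ?thesis
    using c by (simp add: norm_blinfun_bound ennreal_leI)
qed

lemma mat_norm_1: "mat_norm 1 x = ennreal (norm (x 0 0))"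
  using mat_norm_le_sum[of 1 x] norm_entry_le_mat_norm[of 0 1 0 x] by simp

text \<open>With the operator norm in this form, it is the level 1 instance of the suprema that make
  up \<open>cb_norm_on\<close>, and both inequalities become cases of one estimate at level
  \<open>n\<close>.\<close>

lemma op_norm_on_conv_mat_norm:
  "op_norm_on N T = (SUP x\<in>{x\<in>matrices_over 1 N. mat_norm 1 x \<le> 1}. mat_norm 1 (map_ampl T x))"
proof -
  have "{x \<in> N. norm x \<le> 1} = (\<lambda>x. x 0 0) ` {x\<in>matrices_over 1 N. mat_norm 1 x \<le> 1}"
  proof
    show "{x \<in> N. norm x \<le> 1} \<subseteq> (\<lambda>x. x 0 0) ` {x\<in>matrices_over 1 N. mat_norm 1 x \<le> 1}"
    proof
      fix a assume "a \<in> {x \<in> N. norm x \<le> 1}"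
      then show "a \<in> (\<lambda>x. x 0 0) ` {x\<in>matrices_over 1 N. mat_norm 1 x \<le> 1}"
        \<comment> \<open>Any matrix with entry \<open>a\<close> at position (0, 0) would do as
          preimage; the constant one is the simplest.\<close>
        by (intro image_eqI[where x = "\<lambda>i j. a"])
          (auto simp: matrices_over_def mat_norm_1[unfolded One_nat_def])
    qed
  qed (auto simp: matrices_over_def mat_norm_1[unfolded One_nat_def])
  then show ?thesis
    by (simp add: op_norm_on_def image_image mat_norm_1[unfolded One_nat_def] map_ampl_def)
qed

text \<open>The usual scaling argument for operator norms, at a fixed level \<open>n\<close>: divide
  \<open>y\<close> by its norm and use homogeneity of \<open>T\<close> entrywise.\<close>

lemma mat_norm_map_ampl_le:
  assumes N: "\<And>r a. a \<in> N \<Longrightarrow> r *\<^sub>R a \<in> N"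
    and T: "\<And>r a. a \<in> N \<Longrightarrow> T (r *\<^sub>R a) = r *\<^sub>R T a"
    and y: "y \<in> matrices_over n N"
  shows "mat_norm n (map_ampl T y) \<le> mat_norm n y *
    (SUP x\<in>{x\<in>matrices_over n N. mat_norm n x \<le> 1}. mat_norm n (map_ampl T x))"
    (is "_ \<le> _ * ?B")
proof -
  obtain c where c: "mat_norm n y = ennreal c" "0 \<le> c"
    using mat_norm_finite[of n y] by (cases "mat_norm n y") auto
  show ?thesis
  proof (cases "c = 0")
    \<comment> \<open>Rescaling does not help here, as \<open>?B\<close> may be infinite.\<close>
    case True
    have "map_ampl T y i j = 0 *\<^sub>R (0 :: 'a \<Rightarrow>\<^sub>L 'a)" if "i < n" "j < n" for i j
    proof -
      have "y i j = 0"
        using norm_entry_le_mat_norm[OF that, of y] c True by simp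
      moreover have "y i j \<in> N"
        using y that by (simp add: matrices_over_def)
      ultimately show ?thesis
        using T[of "y i j" 0] by (simp add: map_ampl_def)
    qed
    \<comment> \<open>The right side of the goal is 0 even for infinite \<open>?B\<close>, so the
      left side has to vanish. Writing the zero matrix as a multiple by 0 lets
      \<open>mat_norm_scaleR\<close> compute its norm.\<close>
    then have "mat_norm n (map_ampl T y) = mat_norm n (\<lambda>i j. 0 *\<^sub>R (0 :: 'a \<Rightarrow>\<^sub>L 'a))"
      by (rule mat_norm_cong)
    then show ?thesis
      by (simp only: mat_norm_scaleR) simp
  next
    case False
    then have "0 < c" using c by simp
    define z where "z = (\<lambda>i j. (1 / c) *\<^sub>R y i j)"
    have "z \<in> matrices_over n N"
      using y N by (simp add: z_def matrices_over_def)
    moreover have "mat_norm n z \<le> 1"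
      using \<open>0 < c\<close> c by (simp add: z_def mat_norm_scaleR flip: ennreal_mult)
    ultimately have "mat_norm n (map_ampl T z) \<le> ?B"
      by (intro SUP_upper) simp
    moreover have "mat_norm n (map_ampl T y) = mat_norm n (\<lambda>i j. c *\<^sub>R map_ampl T z i j)"
    proof (rule mat_norm_cong)
      fix i j assume "i < n" "j < n"
      then show "map_ampl T y i j = c *\<^sub>R map_ampl T z i j"
        using y T \<open>0 < c\<close> by (simp add: z_def map_ampl_def matrices_over_def)
    qed
    ultimately show ?thesis
      using c by (simp add: mat_norm_scaleR mult_left_mono)
  qed
qed

text \<open>Amplifications act entrywise, so subtracting the amplified \<open>E\<close> works at
  each matrix level as it does for single operators. Keeping \<open>n\<close> fixed serves both the
  plain and the completely bounded inequality.\<close>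

lemma cost_level_le:
  assumes N: "von_neumann_algebra N"
    and E: "E ` N \<subseteq> N"
    and lin: "clinear_map_on N \<Phi>"
    and fix_E: "\<forall>x\<in>N. \<Phi> (E x) = E x"
  shows "cost_level n N S \<Phi> \<le> cost_level n N S E *
    (SUP x\<in>{x\<in>matrices_over n N. mat_norm n x \<le> 1}. mat_norm n (map_ampl (\<lambda>x. \<Phi> x - x) x))"
    (is "_ \<le> _ * ?B")
  unfolding cost_level_def[of n N S \<Phi>]
proof (rule SUP_least)
  fix x assume x: "x \<in> {x \<in> matrices_over n N. mat_selfadjoint n x \<and> commutator_seminorm n S x \<le> 1}"
  have mem: "x i j \<in> N" "E (x i j) \<in> N" if "i < n" "j < n" for i j
    using x E that by (auto simp: matrices_over_def)
  let ?y = "mat_diff x (map_ampl E x)"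
  \<comment> \<open>In each entry the two copies of \<open>E (x i j)\<close> cancel, one of them
    coming from \<open>\<Phi> (E (x i j))\<close>.\<close>
  have "mat_norm n (mat_diff (map_ampl \<Phi> x) x) = mat_norm n (map_ampl (\<lambda>x. \<Phi> x - x) ?y)"
    by (rule mat_norm_cong)
      (simp add: mat_diff_def map_ampl_def clinear_map_on_diff[OF N lin] mem fix_E)
  \<comment> \<open>Here \<open>?B\<close> ranges over the whole unit ball of matrices over
    \<open>N\<close>, so it is enough that the entries of \<open>?y\<close> lie in
    \<open>N\<close>.\<close>
  also have "\<dots> \<le> mat_norm n ?y * ?B"
  proof (rule mat_norm_map_ampl_le)
    show "?y \<in> matrices_over n N"
      by (simp add: matrices_over_def mat_diff_def map_ampl_def von_neumann_algebra_diff[OF N] mem)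
  qed (simp_all add: von_neumann_algebra_scaleR[OF N] clinear_map_on_scaleR[OF lin]
      scaleR_diff_right)
  \<comment> \<open>Up to sign, \<open>?y\<close> is the displacement of \<open>x\<close> under
    \<open>E\<close>, and the constraints on \<open>x\<close> do not involve the channel.\<close>
  also have "mat_norm n ?y \<le> cost_level n N S E"
    unfolding cost_level_def mat_norm_minus[of n x] by (rule SUP_upper[OF x])
  finally show "mat_norm n (mat_diff (map_ampl \<Phi> x) x) \<le> cost_level n N S E * ?B"
    by (simp add: mult_right_mono)
qed

theorem proposition3p7:
  fixes N S :: "('h::complex_hilbert \<Rightarrow>\<^sub>L 'h) set"
    and E \<Phi> :: "('h \<Rightarrow>\<^sub>L 'h) \<Rightarrow> ('h \<Rightarrow>\<^sub>L 'h)"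
  assumes "von_neumann_algebra N"
    and "S \<subseteq> bounded_ops" and "finite S"
    and "von_neumann_algebra (commutant S)"
    and "conditional_expectation N (commutant S \<inter> N) E"
    and "normal_map N (commutant S \<inter> N) E"
    and "channel N \<Phi>"
    and "\<forall>x\<in>N. \<Phi> (E x) = E x"
  shows "cost N S \<Phi> \<le> cost N S E * op_norm_on N (\<lambda>x. \<Phi> x - x) \<and>
    cost_cb N S \<Phi> \<le> cost_cb N S E * cb_norm_on N (\<lambda>x. \<Phi> x - x)"
proof
  have level: "cost_level n N S \<Phi> \<le> cost_level n N S E *
    (SUP x\<in>{x\<in>matrices_over n N. mat_norm n x \<le> 1}. mat_norm n (map_ampl (\<lambda>x. \<Phi> x - x) x))" for n
    using assms by (intro cost_level_le) (auto simp: conditional_expectation_def channel_def)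
  show "cost N S \<Phi> \<le> cost N S E * op_norm_on N (\<lambda>x. \<Phi> x - x)"
    using level[of 1] unfolding cost_def op_norm_on_conv_mat_norm .
  show "cost_cb N S \<Phi> \<le> cost_cb N S E * cb_norm_on N (\<lambda>x. \<Phi> x - x)"
    unfolding cost_cb_def[of N S \<Phi>]
  proof (rule SUP_least)
    fix n :: nat assume n: "n \<in> {1..}"
    \<comment> \<open>Both factors of the level \<open>n\<close> bound are enlarged separately to
      their suprema over all levels.\<close>
    show "cost_level n N S \<Phi> \<le> cost_cb N S E * cb_norm_on N (\<lambda>x. \<Phi> x - x)"
      unfolding cost_cb_def cb_norm_on_def
      by (intro order_trans[OF level] mult_mono SUP_upper n) simp_all
  qed
qed

end
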